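(* Let $V$ be a finite nonempty set and let $M\subset\mathbb{R}^V$ be a finite nonempty set of nonnegative functions on $V$. For $v\in V$ let $\hat v:M\to\mathbb{R}$ be given by $\hat v(m)=m(v)$, and let $\hat V=\{\hat v: v\in V\}$. Then the sets of supporting weights and of covering weights for $M$ (weights on $V$) and for $\hat V$ (weights on $M$) are all nonempty. Moreover, let $(\underline{\alpha}^M,\underline{x}^M)$, $(\overline{\alpha}^M,\overline{x}^M)$, $(\underline{\alpha}^{\hat V},\underline{x}^{\hat V})$, $(\overline{\alpha}^{\hat V},\overline{x}^{\hat V})$ be any solutions of Problems $A$, $B$, $\hat A$, $\hat B$ respectively (see context). Then the following hold. 1. The linear programming problem $\hat B$ is the dual of the linear programming problem $A$, and therefore $\overline{\alpha}^{\hat V}=\underline{\alpha}^M$. 2. The linear programming problem $\hat A$ is the dual of the linear programming problem $B$, and therefore $\overline{\alpha}^{M}=\underline{\alpha}^{\hat V}$. 3. The following complementary slackness relations hold: $$\sum_{v\in V} m(v)\,\underline{x}^M(v)=\underline{\alpha}^M\quad\text{for every } m\in M \text{ with } \overline{x}^{\hat V}(m)\neq 0,$$ $$\sum_{m\in M} m(v)\,\overline{x}^{\hat V}(m)=\underline{\alpha}^M\quad\text{for every } v\in V \text{ with } \underline{x}^{M}(v)\neq 0,$$ $$\sum_{v\in V} m(v)\,\overline{x}^M(v)=\underline{\alpha}^{\hat V}\quad\text{for every } m\in M \text{ with } \underline{x}^{\hat V}(m)\neq 0,$$ $$\sum_{m\in M} m(v)\,\underline{x}^{\hat V}(m)=\underline{\alpha}^{\hat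 V}\quad\text{for every } v\in V \text{ with } \overline{x}^{M}(v)\neq 0.$$ 4. For every $m\in M$, $$\underline{r}^M(m)\ge\underline{\alpha}^M\qquad\text{and}\qquad \overline{s}^M(m)\le\overline{\alpha}^M,$$ where $\underline{r}^M(f)=\sum_{v\in V}f(v)\,\underline{x}^M(v)$ and $\overline{s}^M(f)=\sum_{v\in V}f(v)\,\overline{x}^M(v)$ for a nonnegative function $f$ on $V$. (Thus every $m\in M$ satisfies the criterion by which a function $f$ on $V$ is called relevant to $M$, namely $\underline{r}^M(f)\ge\underline{\alpha}^M$.)
   Context: For a finite set $S$, a weight on $S$ is a nonnegative function $x\in\mathbb{R}^S$ with $\sum_{s\in S}x(s)=1$; the set of all weights on $S$ is denoted $\Delta_S$. For $x,y\in\mathbb{R}^S$ write $(x,y)_S=\sum_{s\in S}x(s)y(s)$. For a finite set $F$ of nonnegative functions on $S$, a weight $\underline{x}$ on $S$ is called supporting for $F$ if $\min_{f\in F}(\underline{x},f)_S\ge\min_{f\in F}(x,f)_S$ for every weight $x$ on $S$; a weight $\overline{x}$ on $S$ is called covering for $F$ if $\max_{f\in F}(\overline{x},f)_S\le\max_{f\in F}(x,f)_S$ for every weight $x$ on $S$. These notions are applied with $S=V$, $F=M$ and with $S=M$, $F=\hat V$. The four linear programming problems are as follows (in each, $\alpha\in\mathbb{R}$ is a free variable; a solution is an optimal pair). Problem $A$: find all pairs $(\underline{\alpha}^M,\underline{x}^M)$ that maximize $\alpha$ over pairs $(\alpha,x)$, $x\in\mathbb{R}^V$, subject to $\sum_{v\in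 V}x(v)=1$, $x(v)\ge0$ for all $v\in V$, and $\alpha-(x,m)_V\le0$ for all $m\in M$. Problem $B$: find all pairs $(\overline{\alpha}^M,\overline{x}^M)$ that minimize $\alpha$ over pairs $(\alpha,x)$, $x\in\mathbb{R}^V$, subject to $\sum_{v\in V}x(v)=1$, $x(v)\ge0$ for all $v\in V$, and $\alpha-(x,m)_V\ge0$ for all $m\in M$. Problem $\hat A$: find all pairs $(\underline{\alpha}^{\hat V},\underline{x}^{\hat V})$ that maximize $\alpha$ over pairs $(\alpha,x)$, $x\in\mathbb{R}^M$, subject to $\sum_{m\in M}x(m)=1$, $x(m)\ge0$ for all $m\in M$, and $\alpha-(x,\hat v)_M\le0$ for all $v\in V$. Problem $\hat B$: find all pairs $(\overline{\alpha}^{\hat V},\overline{x}^{\hat V})$ that minimize $\alpha$ over pairs $(\alpha,x)$, $x\in\mathbb{R}^M$, subject to $\sum_{m\in M}x(m)=1$, $x(m)\ge0$ for all $m\in M$, and $\alpha-(x,\hat v)_M\ge0$ for all $v\in V$. The supporting (resp. covering) weights for $M$ are the $x$-components of the solutions of Problem $A$ (resp. $B$), and the supporting (resp. covering) weights for $\hat V$ are the $x$-components of the solutions of Problem $\hat A$ (resp. $\hat B$). "Dual" means the standard linear programming dual, in which an equality constraint corresponds to a free variable and an inequality constraint to a sign-restricted variable. A function $f$ on $V$ is called relevant to $M$ if $\underline{r}^M(f)\ge\underline{\alpha}^M$. *)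

theory Defs
  imports Complex_Main "HOL-Library.FuncSet"
begin

text \<open>
  The space of real functions on a finite set \<open>S\<close> is rendered as \<open>extensional S\<close>, so that
  equality of elements is equality of functions on \<open>S\<close>.
\<close>

definition nonneg_functions :: "'a set \<Rightarrow> ('a \<Rightarrow> real) set" where
  "nonneg_functions S = {f \<in> extensional S. \<forall>s\<in>S. 0 \<le> f s}"

definition weights :: "'a set \<Rightarrow> ('a \<Rightarrow> real) set" where
  "weights S = {x \<in> nonneg_functions S. (\<Sum>s\<in>S. x s) = 1}"

definition pairing :: "'a set \<Rightarrow> ('a \<Rightarrow> real) \<Rightarrow> ('a \<Rightarrow> real) \<Rightarrow> real" where
  "pairing S x y = (\<Sum>s\<in>S. x s * y s)"

definition supporting_weights :: "'a set \<Rightarrow> ('a \<Rightarrow> real) set \<Rightarrow> ('a \<Rightarrow> real) set" where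
  "supporting_weights S F =
    {x \<in> weights S. \<forall>y\<in>weights S. Min (pairing S x ` F) \<ge> Min (pairing S y ` F)}"

definition covering_weights :: "'a set \<Rightarrow> ('a \<Rightarrow> real) set \<Rightarrow> ('a \<Rightarrow> real) set" where
  "covering_weights S F =
    {x \<in> weights S. \<forall>y\<in>weights S. Max (pairing S x ` F) \<le> Max (pairing S y ` F)}"

definition hat :: "('a \<Rightarrow> real) set \<Rightarrow> 'a \<Rightarrow> (('a \<Rightarrow> real) \<Rightarrow> real)" where
  "hat M v = (\<lambda>m\<in>M. m v)"

datatype lp_sense = Maximize | Minimize

datatype lp_sign = Nonneg | Nonpos | Free

datatype lp_relation = Le | Ge | Eq

record ('j, 'i) lp =
  lp_sense :: lp_sense
  lp_vars :: "'j set"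
  lp_cons :: "'i set"
  lp_objective :: "'j \<Rightarrow> real"
  lp_coeff :: "'i \<Rightarrow> 'j \<Rightarrow> real"
  lp_rhs :: "'i \<Rightarrow> real"
  lp_sign :: "'j \<Rightarrow> lp_sign"
  lp_relation :: "'i \<Rightarrow> lp_relation"

fun sign_holds :: "lp_sign \<Rightarrow> real \<Rightarrow> bool" where
  "sign_holds Nonneg t \<longleftrightarrow> t \<ge> 0"
| "sign_holds Nonpos t \<longleftrightarrow> t \<le> 0"
| "sign_holds Free t \<longleftrightarrow> True"

fun relation_holds :: "lp_relation \<Rightarrow> real \<Rightarrow> real \<Rightarrow> bool" where
  "relation_holds Le s t \<longleftrightarrow> s \<le> t"
| "relation_holds Ge s t \<longleftrightarrow> s \<ge> t"
| "relation_holds Eq s t \<longleftrightarrow> s = t"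

definition lp_value :: "('j, 'i) lp \<Rightarrow> ('j \<Rightarrow> real) \<Rightarrow> real" where
  "lp_value P z = (\<Sum>j\<in>lp_vars P. lp_objective P j * z j)"

definition lp_feasible :: "('j, 'i) lp \<Rightarrow> ('j \<Rightarrow> real) \<Rightarrow> bool" where
  "lp_feasible P z \<longleftrightarrow>
    z \<in> extensional (lp_vars P) \<and>
    (\<forall>j\<in>lp_vars P. sign_holds (lp_sign P j) (z j)) \<and>
    (\<forall>i\<in>lp_cons P.
      relation_holds (lp_relation P i) (\<Sum>j\<in>lp_vars P. lp_coeff P i j * z j) (lp_rhs P i))"

definition lp_optimal :: "('j, 'i) lp \<Rightarrow> ('j \<Rightarrow> real) \<Rightarrow> bool" where
  "lp_optimal P z \<longleftrightarrow>
    lp_feasible P z \<and>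
    (\<forall>w. lp_feasible P w \<longrightarrow>
      (case lp_sense P of
         Maximize \<Rightarrow> lp_value P w \<le> lp_value P z
       | Minimize \<Rightarrow> lp_value P z \<le> lp_value P w))"

fun dual_sense :: "lp_sense \<Rightarrow> lp_sense" where
  "dual_sense Maximize = Minimize"
| "dual_sense Minimize = Maximize"

text \<open>The first argument of the next two functions is the sense of the primal problem.\<close>

fun dual_sign :: "lp_sense \<Rightarrow> lp_relation \<Rightarrow> lp_sign" where
  "dual_sign Maximize Le = Nonneg"
| "dual_sign Maximize Ge = Nonpos"
| "dual_sign Minimize Le = Nonpos"
| "dual_sign Minimize Ge = Nonneg"
| "dual_sign _ Eq = Free"

fun dual_relation :: "lp_sense \<Rightarrow> lp_sign \<Rightarrow> lp_relation" where
  "dual_relation Maximize Nonneg = Ge"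
| "dual_relation Maximize Nonpos = Le"
| "dual_relation Minimize Nonneg = Le"
| "dual_relation Minimize Nonpos = Ge"
| "dual_relation _ Free = Eq"

text \<open>
  \<open>D\<close> is the dual of \<open>P\<close>. The data of the two programs are compared only on the index sets of
  variables and constraints, since their values elsewhere are irrelevant.
\<close>

definition is_lp_dual :: "('i, 'j) lp \<Rightarrow> ('j, 'i) lp \<Rightarrow> bool" where
  "is_lp_dual D P \<longleftrightarrow>
    lp_sense D = dual_sense (lp_sense P) \<and>
    lp_vars D = lp_cons P \<and>
    lp_cons D = lp_vars P \<and>
    (\<forall>i\<in>lp_cons P. lp_objective D i = lp_rhs P i \<and>
       lp_sign D i = dual_sign (lp_sense P) (lp_relation P i)) \<and>
    (\<forall>j\<in>lp_vars P. lp_rhs D j = lp_objective P j \<and>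
       lp_relation D j = dual_relation (lp_sense P) (lp_sign P j)) \<and>
    (\<forall>i\<in>lp_cons P. \<forall>j\<in>lp_vars P. lp_coeff D j i = lp_coeff P i j)"

text \<open>
  For a family \<open>f\<close> of functions on \<open>S\<close> indexed by \<open>I\<close>, \<open>lower_lp S I f\<close> maximizes \<open>\<alpha>\<close> and
  \<open>upper_lp S I f\<close> minimizes \<open>\<alpha>\<close>, over pairs of a free variable \<open>\<alpha>\<close> and a weight \<open>x\<close> on \<open>S\<close>,
  subject to \<open>\<alpha> - pairing S x (f i) \<le> 0\<close>, respectively \<open>\<ge> 0\<close>, for all \<open>i \<in> I\<close>. The variable \<open>\<alpha>\<close>
  has index \<open>None\<close>, the variable \<open>x s\<close> has index \<open>Some s\<close>; the constraint \<open>None\<close> is the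
  normalization of \<open>x\<close>, the constraint \<open>Some i\<close> is the inequality for \<open>f i\<close>.
  Constraints are indexed by \<open>I\<close> and not by the range of \<open>f\<close>, which matters for duality
  when \<open>f\<close> is not injective.
\<close>

fun level_coeff ::
  "('i \<Rightarrow> 's \<Rightarrow> real) \<Rightarrow> 'i option \<Rightarrow> 's option \<Rightarrow> real" where
  "level_coeff f None None = 0"
| "level_coeff f None (Some s) = 1"
| "level_coeff f (Some i) None = 1"
| "level_coeff f (Some i) (Some s) = - f i s"

definition lower_lp ::
  "'s set \<Rightarrow> 'i set \<Rightarrow> ('i \<Rightarrow> 's \<Rightarrow> real) \<Rightarrow> ('s option, 'i option) lp" where
  "lower_lp S I f =
    \<lparr> lp_sense = Maximize,
      lp_vars = insert None (Some ` S),
      lp_cons = insert None (Some ` I),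
      lp_objective = case_option 1 (\<lambda>s. 0),
      lp_coeff = level_coeff f,
      lp_rhs = case_option 1 (\<lambda>i. 0),
      lp_sign = case_option Free (\<lambda>s. Nonneg),
      lp_relation = case_option Eq (\<lambda>i. Le) \<rparr>"

definition upper_lp ::
  "'s set \<Rightarrow> 'i set \<Rightarrow> ('i \<Rightarrow> 's \<Rightarrow> real) \<Rightarrow> ('s option, 'i option) lp" where
  "upper_lp S I f =
    \<lparr> lp_sense = Minimize,
      lp_vars = insert None (Some ` S),
      lp_cons = insert None (Some ` I),
      lp_objective = case_option 1 (\<lambda>s. 0),
      lp_coeff = level_coeff f,
      lp_rhs = case_option 1 (\<lambda>i. 0),
      lp_sign = case_option Free (\<lambda>s. Nonneg),
      lp_relation = case_option Eq (\<lambda>i. Ge) \<rparr>"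

definition problem_A ::
  "'a set \<Rightarrow> ('a \<Rightarrow> real) set \<Rightarrow> ('a option, ('a \<Rightarrow> real) option) lp" where
  "problem_A V M = lower_lp V M (\<lambda>m. m)"

definition problem_B ::
  "'a set \<Rightarrow> ('a \<Rightarrow> real) set \<Rightarrow> ('a option, ('a \<Rightarrow> real) option) lp" where
  "problem_B V M = upper_lp V M (\<lambda>m. m)"

definition problem_hat_A ::
  "'a set \<Rightarrow> ('a \<Rightarrow> real) set \<Rightarrow> (('a \<Rightarrow> real) option, 'a option) lp" where
  "problem_hat_A V M = lower_lp M V (hat M)"

definition problem_hat_B ::
  "'a set \<Rightarrow> ('a \<Rightarrow> real) set \<Rightarrow> (('a \<Rightarrow> real) option, 'a option) lp" where
  "problem_hat_B V M = upper_lp M V (hat M)"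

text \<open>A pair \<open>(\<alpha>, x)\<close> is the point \<open>case_option \<alpha> x\<close> of the program.\<close>

definition is_solution :: "('s option, 'i) lp \<Rightarrow> real \<times> ('s \<Rightarrow> real) \<Rightarrow> bool" where
  "is_solution P = (\<lambda>(\<alpha>, x). lp_optimal P (case_option \<alpha> x))"

lemma ex_option_fun: "\<exists>\<alpha> x. w = case_option \<alpha> x"
proof -
  have "w = case_option (w None) (\<lambda>s. w (Some s))"
    by (auto simp: fun_eq_iff split: option.split)
  then show ?thesis by blast
qed

lemma all_option_fun: "(\<forall>w. Q w) \<longleftrightarrow> (\<forall>\<alpha> x. Q (case_option \<alpha> x))"
  by (metis ex_option_fun)

lemma extensional_case_option:
  "case_option \<alpha> x \<in> extensional (insert None (Some ` S)) \<longleftrightarrow> x \<in> extensional S"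
  by (auto simp: extensional_def split: option.splits)

lemma lp_feasible_lower_lp_iff:
  assumes "finite S"
  shows "lp_feasible (lower_lp S I f) (case_option \<alpha> x) \<longleftrightarrow>
    x \<in> weights S \<and> (\<forall>i\<in>I. \<alpha> - pairing S x (f i) \<le> 0)"
  unfolding lp_feasible_def
  by (auto simp: lower_lp_def extensional_case_option sum.reindex assms weights_def
      nonneg_functions_def pairing_def sum_negf mult.commute)

lemma lp_feasible_upper_lp_iff:
  assumes "finite S"
  shows "lp_feasible (upper_lp S I f) (case_option \<alpha> x) \<longleftrightarrow>
    x \<in> weights S \<and> (\<forall>i\<in>I. \<alpha> - pairing S x (f i) \<ge> 0)"
  unfolding lp_feasible_def
  by (auto simp: upper_lp_def extensional_case_option sum.reindex assms weights_def
      nonneg_functions_def pairing_def sum_negf mult.commute)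

lemma is_solution_lower_lp_iff:
  assumes "finite S"
  shows "is_solution (lower_lp S I f) (\<alpha>, x) \<longleftrightarrow>
    x \<in> weights S \<and> (\<forall>i\<in>I. \<alpha> - pairing S x (f i) \<le> 0) \<and>
    (\<forall>\<beta> y. y \<in> weights S \<and> (\<forall>i\<in>I. \<beta> - pairing S y (f i) \<le> 0) \<longrightarrow> \<beta> \<le> \<alpha>)"
proof -
  have "lp_value (lower_lp S I f) (case_option \<beta> y) = \<beta>" for \<beta> y
    by (simp add: lp_value_def lower_lp_def sum.reindex assms)
  moreover have "lp_sense (lower_lp S I f) = Maximize" by (simp add: lower_lp_def)
  ultimately show ?thesis
    unfolding is_solution_def lp_optimal_def all_option_fun
    by (simp add: lp_feasible_lower_lp_iff assms)
qed

lemma is_solution_upper_lp_iff: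
  assumes "finite S"
  shows "is_solution (upper_lp S I f) (\<alpha>, x) \<longleftrightarrow>
    x \<in> weights S \<and> (\<forall>i\<in>I. \<alpha> - pairing S x (f i) \<ge> 0) \<and>
    (\<forall>\<beta> y. y \<in> weights S \<and> (\<forall>i\<in>I. \<beta> - pairing S y (f i) \<ge> 0) \<longrightarrow> \<alpha> \<le> \<beta>)"
proof -
  have "lp_value (upper_lp S I f) (case_option \<beta> y) = \<beta>" for \<beta> y
    by (simp add: lp_value_def upper_lp_def sum.reindex assms)
  moreover have "lp_sense (upper_lp S I f) = Minimize" by (simp add: upper_lp_def)
  ultimately show ?thesis
    unfolding is_solution_def lp_optimal_def all_option_fun
    by (simp add: lp_feasible_upper_lp_iff assms)
qed

text \<open>
  \<open>score V x f\<close> is the lower score of \<open>f\<close> when \<open>x\<close> is the chosen supporting weight, and its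
  upper score when \<open>x\<close> is the chosen covering weight. Relevance is relative to the chosen
  solution \<open>(\<alpha>, x)\<close> of the problem of supporting weights.
\<close>

definition score :: "'a set \<Rightarrow> ('a \<Rightarrow> real) \<Rightarrow> ('a \<Rightarrow> real) \<Rightarrow> real" where
  "score V x f = (\<Sum>v\<in>V. f v * x v)"

definition relevant :: "'a set \<Rightarrow> real \<times> ('a \<Rightarrow> real) \<Rightarrow> ('a \<Rightarrow> real) \<Rightarrow> bool" where
  "relevant V = (\<lambda>(\<alpha>, x) f. score V x f \<ge> \<alpha>)"

end

theory Submission
  imports Defs "HOL-Analysis.Function_Topology"
begin

text \<open>
  The four programs are the two players' programs in two matrix games, one played with the matrix
  \<open>(v, m) \<mapsto> m v\<close> (\<open>problem_A\<close> and \<open>problem_hat_B\<close>) and one with its transpose (\<open>problem_hat_A\<close> and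
  \<open>problem_B\<close>), so everything reduces to the minimax theorem for one arbitrary real matrix.

  The set of weights is compact in the product topology, whence optimal weights exist. For the
  minimax theorem, fix a level \<open>\<alpha>\<close> and let \<open>y\<close> be a weight on the columns that minimizes the sum
  over the rows \<open>s\<close> of the squares of the excess of row \<open>s\<close>, that is of the positive part of
  the mean of row \<open>s\<close> under \<open>y\<close> minus \<open>\<alpha>\<close>. If the minimum is \<open>0\<close>, then \<open>y\<close> keeps every row at or
  below \<open>\<alpha>\<close>. Otherwise the excesses, normalized, are a weight on the rows: since moving \<open>y\<close> towards
  any vertex of the simplex does not decrease the sum of squares, this weight puts every column
  strictly above \<open>\<alpha>\<close> (\<open>column_weight_or_row_weight\<close>). When \<open>\<alpha>\<close> is the largest level that a weight
  on the rows can guarantee, the second case is excluded, so the levels of the two programs agree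
  (\<open>lower_upper_same_level\<close>). Complementary slackness is then the remark that a weighted mean of
  nonnegative slacks vanishes only if every slack of nonzero weight does.
\<close>

section \<open>Existence of optimal weights\<close>

lemma continuous_on_pairing: "continuous_on X (\<lambda>x. pairing S x f)"
  unfolding pairing_def
  by (intro continuous_intros continuous_on_subset[OF continuous_on_product_coordinates]) auto

lemma continuous_on_Min_image:
  fixes h :: "'i \<Rightarrow> 'x::topological_space \<Rightarrow> real"
  assumes "finite F" "F \<noteq> {}" "\<And>f. f \<in> F \<Longrightarrow> continuous_on X (h f)"
  shows "continuous_on X (\<lambda>x. Min ((\<lambda>f. h f x) ` F))"
  using assms by (induction F rule: finite_ne_induct) (auto intro!: continuous_on_min)

lemma continuous_on_Max_image:
  fixes h :: "'i \<Rightarrow> 'x::topological_space \<Rightarrow> real"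
  assumes "finite F" "F \<noteq> {}" "\<And>f. f \<in> F \<Longrightarrow> continuous_on X (h f)"
  shows "continuous_on X (\<lambda>x. Max ((\<lambda>f. h f x) ` F))"
  using assms by (induction F rule: finite_ne_induct) (auto intro!: continuous_on_max)

text \<open>
  The simplex is a closed subset of a product of compact sets; at the points outside \<open>S\<close> the
  factor is the singleton of the default value, because weights are extensional.
\<close>

lemma compact_weights:
  assumes "finite S"
  shows "compact (weights S)"
proof -
  let ?K = "PiE UNIV (\<lambda>s. if s \<in> S then {0..1} else {undefined :: real})"
  have "compactin (product_topology (\<lambda>s. euclidean) UNIV) ?K"
    by (auto simp: compactin_PiE)
  then have K: "compact ?K"
    by (simp add: euclidean_product_topology)
  have "closed {x. (\<Sum>s\<in>S. x s) = (1::real)}"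
    by (intro closed_Collect_eq continuous_intros continuous_on_product_coordinates)
  moreover have "weights S = ?K \<inter> {x. (\<Sum>s\<in>S. x s) = 1}"
  proof
    show "weights S \<subseteq> ?K \<inter> {x. (\<Sum>s\<in>S. x s) = 1}"
    proof
      fix x assume x: "x \<in> weights S"
      have "x s \<le> 1" if "s \<in> S" for s
        using member_le_sum[OF that, of x] x assms
        by (auto simp: weights_def nonneg_functions_def)
      then show "x \<in> ?K \<inter> {x. (\<Sum>s\<in>S. x s) = 1}"
        using x by (auto simp: weights_def nonneg_functions_def extensional_def)
    qed
    show "?K \<inter> {x. (\<Sum>s\<in>S. x s) = 1} \<subseteq> weights S"
    proof
      fix x assume x: "x \<in> ?K \<inter> {x. (\<Sum>s\<in>S. x s) = 1}"
      then have "x s \<in> (if s \<in> S then {0..1} else {undefined})" for s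
        by (auto simp: PiE_def Pi_def)
      then have "x s \<ge> 0" if "s \<in> S" for s
        using that by (metis atLeastAtMost_iff)
      moreover have "x s = undefined" if "s \<notin> S" for s
        using that \<open>\<And>s. x s \<in> (if s \<in> S then {0..1} else {undefined})\<close>
        by (metis singletonD)
      ultimately show "x \<in> weights S"
        using x by (auto simp: weights_def nonneg_functions_def extensional_def)
    qed
  qed
  ultimately show ?thesis
    using K by (simp add: compact_Int_closed)
qed

lemma vertex_in_weights:
  assumes "finite S" "s \<in> S"
  shows "(\<lambda>r\<in>S. if r = s then 1 else 0) \<in> weights S"
  using assms by (auto simp: weights_def nonneg_functions_def)

lemma weights_nonempty:
  assumes "finite S" "S \<noteq> {}"
  shows "weights S \<noteq> {}"
  using assms vertex_in_weights by fast

lemma supporting_weights_nonempty: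
  assumes "finite S" "S \<noteq> {}" "finite F" "F \<noteq> {}"
  shows "supporting_weights S F \<noteq> {}"
proof -
  have "continuous_on (weights S) (\<lambda>x. Min (pairing S x ` F))"
    using continuous_on_Min_image[OF assms(3,4) continuous_on_pairing] .
  then show ?thesis
    using continuous_attains_sup[OF compact_weights[OF assms(1)] weights_nonempty[OF assms(1,2)]]
    by (fastforce simp: supporting_weights_def)
qed

lemma covering_weights_nonempty:
  assumes "finite S" "S \<noteq> {}" "finite F" "F \<noteq> {}"
  shows "covering_weights S F \<noteq> {}"
proof -
  have "continuous_on (weights S) (\<lambda>x. Max (pairing S x ` F))"
    using continuous_on_Max_image[OF assms(3,4) continuous_on_pairing] .
  then show ?thesis
    using continuous_attains_inf[OF compact_weights[OF assms(1)] weights_nonempty[OF assms(1,2)]]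
    by (fastforce simp: covering_weights_def)
qed

section \<open>Minimax\<close>

text \<open>
  The quadratic majorant holds with equality at \<open>b = 0\<close> and has there the same slope
  \<open>2 * max 0 a\<close> as the left side: it is what replaces differentiation of the sum of squared
  excesses.
\<close>

lemma square_pos_part_add_le:
  fixes a b :: real
  shows "(max 0 (a + b))\<^sup>2 \<le> (max 0 a)\<^sup>2 + 2 * b * max 0 a + b\<^sup>2"
proof -
  have "(max 0 (a + b))\<^sup>2 \<le> (max 0 a + b)\<^sup>2"
  proof (cases "a + b \<le> 0")
    case True
    then show ?thesis by (simp add: max_def)
  next
    case False
    then show ?thesis by (intro power_mono) (auto simp: max_def)
  qed
  then show ?thesis by (simp add: power2_eq_square algebra_simps)
qed

lemma linear_coeff_nonneg:
  fixes D E :: real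
  assumes "E \<ge> 0" and "\<And>u. 0 < u \<Longrightarrow> u \<le> 1 \<Longrightarrow> 0 \<le> 2 * u * D + u\<^sup>2 * E"
  shows "D \<ge> 0"
proof (rule ccontr)
  assume "\<not> D \<ge> 0"
  define u where "u = min 1 (- D / (E + 1))"
  have u: "0 < u" "u \<le> 1"
    using \<open>\<not> D \<ge> 0\<close> assms(1) by (auto simp: u_def divide_neg_pos)
  have "u * (E + 1) \<le> (- D / (E + 1)) * (E + 1)"
    using assms(1) by (intro mult_right_mono) (auto simp: u_def)
  also have "\<dots> = - D"
    using assms(1) by simp
  finally have "u * E < - D"
    using u by (simp add: algebra_simps)
  then have "u * (2 * D + u * E) < 0"
    using u \<open>\<not> D \<ge> 0\<close> by (intro mult_pos_neg) auto
  then show False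
    using assms(2)[OF u] by (simp add: power2_eq_square algebra_simps)
qed

text \<open>
  The heart of the matter: the excesses of the minimizing \<open>y\<close> are, up to normalization, the
  gradient of the penalty in the space of rows. By the first-order conditions at \<open>y\<close>, every column
  has under them at least the mean that the rows' \<open>y\<close>-means have, and that mean exceeds \<open>\<alpha>\<close>
  because only rows above \<open>\<alpha>\<close> count.
\<close>

lemma column_weight_or_row_weight:
  fixes g :: "'s \<Rightarrow> 't \<Rightarrow> real"
  assumes fin: "finite S" "finite T" and "T \<noteq> {}"
  shows "(\<exists>y\<in>weights T. \<forall>s\<in>S. pairing T y (g s) \<le> \<alpha>) \<or>
    (\<exists>x\<in>weights S. \<forall>t\<in>T. \<alpha> < pairing S x (\<lambda>s. g s t))"
proof -
  define p where "p y s = max 0 (pairing T y (g s) - \<alpha>)" for y s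
  define \<phi> where "\<phi> y = (\<Sum>s\<in>S. (p y s)\<^sup>2)" for y
  have "continuous_on (weights T) \<phi>"
    unfolding \<phi>_def p_def by (intro continuous_intros continuous_on_pairing)
  then obtain y where y: "y \<in> weights T" and y_min: "\<And>z. z \<in> weights T \<Longrightarrow> \<phi> y \<le> \<phi> z"
    using continuous_attains_inf[OF compact_weights[OF fin(2)] weights_nonempty[OF fin(2) assms(3)]]
    by blast
  define P where "P = (\<Sum>s\<in>S. p y s)"
  have p_nonneg: "p y s \<ge> 0" for s by (simp add: p_def)
  show ?thesis
  proof (cases "P = 0")
    case True
    then have "p y s = 0" if "s \<in> S" for s
      using that fin(1) p_nonneg sum_nonneg_eq_0_iff[of S "p y"] by (auto simp: P_def)
    then have "pairing T y (g s) \<le> \<alpha>" if "s \<in> S" for s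
      using that by (fastforce simp: p_def)
    then show ?thesis using y by blast
  next
    case False
    then have P_pos: "P > 0"
      using sum_nonneg[of S "p y"] p_nonneg by (auto simp: P_def)
    define x where "x = (\<lambda>s\<in>S. p y s / P)"
    have "(\<Sum>s\<in>S. p y s / P) = 1"
      using P_pos by (simp add: P_def flip: sum_divide_distrib)
    then have "x \<in> weights S"
      using P_pos p_nonneg by (auto simp: x_def weights_def nonneg_functions_def)
    moreover have "\<alpha> < pairing S x (\<lambda>s. g s t)" if t: "t \<in> T" for t
    proof -
      define d where "d s = g s t - pairing T y (g s)" for s
      have "0 \<le> 2 * u * (\<Sum>s\<in>S. p y s * d s) + u\<^sup>2 * (\<Sum>s\<in>S. (d s)\<^sup>2)"
        if u: "0 < u" "u \<le> 1" for u
      proof -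
        \<comment> \<open>the point at the fraction \<open>u\<close> of the way from \<open>y\<close> to the vertex at \<open>t\<close>\<close>
        define z where "z = (\<lambda>r\<in>T. (1 - u) * y r + u * (if r = t then 1 else 0))"
        have "(\<Sum>r\<in>T. z r) = (1 - u) * (\<Sum>r\<in>T. y r) + u"
          using fin(2) t by (simp add: z_def sum.distrib flip: sum_distrib_left)
        then have "z \<in> weights T"
          using y u by (auto simp: z_def weights_def nonneg_functions_def)
        have "pairing T z (g s) = pairing T y (g s) + u * d s" for s
        proof -
          have "pairing T z (g s) =
              (\<Sum>r\<in>T. (1 - u) * (y r * g s r) + u * (if r = t then g s t else 0))"
            unfolding pairing_def z_def by (intro sum.cong) (auto simp: algebra_simps)
          also have "\<dots> = (1 - u) * pairing T y (g s) + u * g s t"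
            using fin(2) t by (simp add: sum.distrib pairing_def flip: sum_distrib_left)
          finally show ?thesis by (simp add: d_def algebra_simps)
        qed
        then have "p z s = max 0 ((pairing T y (g s) - \<alpha>) + u * d s)" for s
          by (simp add: p_def algebra_simps)
        then have "(p z s)\<^sup>2 \<le> (p y s)\<^sup>2 + 2 * (u * d s) * p y s + (u * d s)\<^sup>2" for s
          using square_pos_part_add_le[of "pairing T y (g s) - \<alpha>" "u * d s"] by (simp only: p_def)
        then have "\<phi> z \<le> (\<Sum>s\<in>S. (p y s)\<^sup>2 + 2 * (u * d s) * p y s + (u * d s)\<^sup>2)"
          unfolding \<phi>_def by (intro sum_mono)
        also have "\<dots> = \<phi> y + 2 * u * (\<Sum>s\<in>S. p y s * d s) + u\<^sup>2 * (\<Sum>s\<in>S. (d s)\<^sup>2)"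
          by (simp add: \<phi>_def sum.distrib sum_distrib_left power_mult_distrib algebra_simps)
        finally show ?thesis
          using y_min[OF \<open>z \<in> weights T\<close>] by linarith
      qed
      then have "0 \<le> (\<Sum>s\<in>S. p y s * d s)"
        by (rule linear_coeff_nonneg[rotated]) (simp_all add: sum_nonneg)
      then have "(\<Sum>s\<in>S. p y s * pairing T y (g s)) \<le> (\<Sum>s\<in>S. p y s * g s t)"
        by (simp add: d_def right_diff_distrib sum_subtractf)
      \<comment> \<open>where \<open>p y s\<close> is nonzero, the mean of row \<open>s\<close> is \<open>\<alpha> + p y s\<close>\<close>
      moreover have "(\<Sum>s\<in>S. p y s * pairing T y (g s)) = (\<Sum>s\<in>S. \<alpha> * p y s + (p y s)\<^sup>2)"
        by (intro sum.cong) (auto simp: p_def max_def power2_eq_square algebra_simps)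
      moreover have "\<dots> = \<alpha> * P + (\<Sum>s\<in>S. (p y s)\<^sup>2)"
        by (simp add: sum.distrib sum_distrib_left P_def)
      moreover have "(\<Sum>s\<in>S. (p y s)\<^sup>2) > 0"
      proof -
        obtain s where "s \<in> S" "p y s \<noteq> 0"
          using False sum.not_neutral_contains_not_neutral unfolding P_def by blast
        then show ?thesis using fin(1) by (intro sum_pos2[where i = s]) auto
      qed
      ultimately have "\<alpha> * P < (\<Sum>s\<in>S. p y s * g s t)"
        by linarith
      then have "\<alpha> < (\<Sum>s\<in>S. p y s * g s t) / P"
        using P_pos by (simp add: field_simps)
      also have "\<dots> = pairing S x (\<lambda>s. g s t)"
        by (simp add: pairing_def x_def sum_divide_distrib)
      finally show ?thesis .
    qed
    ultimately show ?thesis by blast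
  qed
qed

section \<open>Duality of the lower and the upper program\<close>

lemma is_lp_dual_upper_lower:
  assumes "\<And>s t. s \<in> S \<Longrightarrow> t \<in> T \<Longrightarrow> g s t = f t s"
  shows "is_lp_dual (upper_lp T S g) (lower_lp S T f)"
  using assms by (auto simp: is_lp_dual_def upper_lp_def lower_lp_def)

lemma is_lp_dual_lower_upper:
  assumes "\<And>s t. s \<in> S \<Longrightarrow> t \<in> T \<Longrightarrow> g s t = f t s"
  shows "is_lp_dual (lower_lp S T f) (upper_lp T S g)"
  using assms by (auto simp: is_lp_dual_def upper_lp_def lower_lp_def)

lemma pairing_interchange:
  assumes "\<And>s t. s \<in> S \<Longrightarrow> t \<in> T \<Longrightarrow> g s t = f t s"
  shows "(\<Sum>t\<in>T. y t * pairing S x (f t)) = (\<Sum>s\<in>S. x s * pairing T y (g s))"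
proof -
  have "(\<Sum>t\<in>T. y t * pairing S x (f t)) = (\<Sum>t\<in>T. \<Sum>s\<in>S. x s * (y t * f t s))"
    by (simp add: pairing_def sum_distrib_left algebra_simps)
  also have "\<dots> = (\<Sum>s\<in>S. \<Sum>t\<in>T. x s * (y t * f t s))"
    by (rule sum.swap)
  also have "\<dots> = (\<Sum>s\<in>S. x s * pairing T y (g s))"
    by (simp add: pairing_def sum_distrib_left assms)
  finally show ?thesis .
qed

lemma sum_weights_const:
  assumes "x \<in> weights S"
  shows "(\<Sum>s\<in>S. x s * c) = c"
  using assms by (simp add: weights_def flip: sum_distrib_right)

lemma weighted_mean_bounds_tight:
  assumes "finite S" "x \<in> weights S" "\<And>s. s \<in> S \<Longrightarrow> h s \<le> c" "c \<le> (\<Sum>s\<in>S. x s * h s)"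
    and "s \<in> S" "x s \<noteq> 0"
  shows "h s = c"
proof -
  have nonneg: "0 \<le> x r * (c - h r)" if "r \<in> S" for r
    using that assms(2,3) by (auto simp: weights_def nonneg_functions_def)
  have "(\<Sum>r\<in>S. x r * (c - h r)) = c - (\<Sum>r\<in>S. x r * h r)"
    using sum_weights_const[OF assms(2)] by (simp add: right_diff_distrib sum_subtractf)
  moreover have "0 \<le> (\<Sum>r\<in>S. x r * (c - h r))"
    using nonneg by (rule sum_nonneg)
  ultimately have "(\<Sum>r\<in>S. x r * (c - h r)) = 0"
    using assms(4) by linarith
  then have "x s * (c - h s) = 0"
    using assms(1,5) nonneg sum_nonneg_eq_0_iff[of S "\<lambda>r. x r * (c - h r)"] by auto
  then show ?thesis using assms(6) by simp
qed

text \<open>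
  No row weight exceeds the optimal lower level \<open>\<alpha>\<close> in every column, so some column weight keeps
  every row at or below \<open>\<alpha>\<close>, which gives \<open>\<beta> \<le> \<alpha>\<close>; the reverse inequality is the double sum
  evaluated in two ways.
\<close>

lemma lower_upper_same_level:
  assumes fin: "finite S" "finite T"
    and tr: "\<And>s t. s \<in> S \<Longrightarrow> t \<in> T \<Longrightarrow> g s t = f t s"
    and lower: "is_solution (lower_lp S T f) (\<alpha>, x)"
    and upper: "is_solution (upper_lp T S g) (\<beta>, y)"
  shows "\<beta> = \<alpha>"
proof (rule antisym)
  have x: "x \<in> weights S" "\<And>t. t \<in> T \<Longrightarrow> \<alpha> \<le> pairing S x (f t)"
    and x_max: "\<And>\<gamma> z. z \<in> weights S \<Longrightarrow> \<forall>t\<in>T. \<gamma> \<le> pairing S z (f t) \<Longrightarrow> \<gamma> \<le> \<alpha>"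
    using lower by (auto simp: is_solution_lower_lp_iff[OF fin(1)])
  have y: "y \<in> weights T" "\<And>s. s \<in> S \<Longrightarrow> pairing T y (g s) \<le> \<beta>"
    and y_min: "\<And>\<gamma> z. z \<in> weights T \<Longrightarrow> \<forall>s\<in>S. pairing T z (g s) \<le> \<gamma> \<Longrightarrow> \<beta> \<le> \<gamma>"
    using upper by (auto simp: is_solution_upper_lp_iff[OF fin(2)])
  have T_nonempty: "T \<noteq> {}"
    using y(1) by (auto simp: weights_def)
  have "\<not> (\<forall>t\<in>T. \<alpha> < pairing S z (\<lambda>s. g s t))" if "z \<in> weights S" for z
  proof
    assume above: "\<forall>t\<in>T. \<alpha> < pairing S z (\<lambda>s. g s t)"
    have "pairing S z (\<lambda>s. g s t) = pairing S z (f t)" if "t \<in> T" for t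
      using tr that by (simp add: pairing_def)
    with above have "\<forall>t\<in>T. \<alpha> < pairing S z (f t)" by simp
    moreover from this have "Min ((\<lambda>t. pairing S z (f t)) ` T) \<le> \<alpha>"
      using x_max[OF that] fin(2) by simp
    ultimately show False
      using fin(2) T_nonempty by (auto simp: Min_le_iff)
  qed
  then show "\<beta> \<le> \<alpha>"
    using column_weight_or_row_weight[OF fin T_nonempty, of g \<alpha>] y_min by blast
  have "\<alpha> = (\<Sum>t\<in>T. y t * \<alpha>)"
    using sum_weights_const[OF y(1)] by simp
  also have "\<dots> \<le> (\<Sum>t\<in>T. y t * pairing S x (f t))"
    using x(2) y(1) by (intro sum_mono mult_left_mono) (auto simp: weights_def nonneg_functions_def)
  also have "\<dots> = (\<Sum>s\<in>S. x s * pairing T y (g s))"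
    by (rule pairing_interchange[OF tr])
  also have "\<dots> \<le> (\<Sum>s\<in>S. x s * \<beta>)"
    using x(1) y(2) by (intro sum_mono mult_left_mono) (auto simp: weights_def nonneg_functions_def)
  also have "\<dots> = \<beta>"
    by (rule sum_weights_const[OF x(1)])
  finally show "\<alpha> \<le> \<beta>" .
qed

text \<open>
  The mean of the rows under \<open>x\<close> equals the mean of the columns under \<open>y\<close>; it is at most \<open>\<alpha>\<close> as
  the first and at least \<open>\<alpha>\<close> as the second, so both bounds are tight wherever the weight is nonzero.
\<close>

lemma complementary_slackness:
  assumes fin: "finite S" "finite T"
    and tr: "\<And>s t. s \<in> S \<Longrightarrow> t \<in> T \<Longrightarrow> g s t = f t s"
    and lower: "is_solution (lower_lp S T f) (\<alpha>, x)"
    and upper: "is_solution (upper_lp T S g) (\<beta>, y)"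
  shows "t \<in> T \<Longrightarrow> y t \<noteq> 0 \<Longrightarrow> pairing S x (f t) = \<alpha>"
    and "s \<in> S \<Longrightarrow> x s \<noteq> 0 \<Longrightarrow> pairing T y (g s) = \<alpha>"
proof -
  have x: "x \<in> weights S" "\<And>t. t \<in> T \<Longrightarrow> \<alpha> \<le> pairing S x (f t)"
    using lower by (auto simp: is_solution_lower_lp_iff[OF fin(1)])
  have y: "y \<in> weights T" "\<And>s. s \<in> S \<Longrightarrow> pairing T y (g s) \<le> \<alpha>"
    using upper lower_upper_same_level[OF assms] by (auto simp: is_solution_upper_lp_iff[OF fin(2)])
  have swap: "(\<Sum>t\<in>T. y t * pairing S x (f t)) = (\<Sum>s\<in>S. x s * pairing T y (g s))"
    by (rule pairing_interchange[OF tr])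
  have "(\<Sum>t\<in>T. y t * \<alpha>) \<le> (\<Sum>t\<in>T. y t * pairing S x (f t))"
    using x(2) y(1) by (intro sum_mono mult_left_mono) (auto simp: weights_def nonneg_functions_def)
  then have rows: "\<alpha> \<le> (\<Sum>s\<in>S. x s * pairing T y (g s))"
    by (simp add: swap sum_weights_const[OF y(1)])
  have "(\<Sum>s\<in>S. x s * pairing T y (g s)) \<le> (\<Sum>s\<in>S. x s * \<alpha>)"
    using x(1) y(2) by (intro sum_mono mult_left_mono) (auto simp: weights_def nonneg_functions_def)
  then have columns: "- \<alpha> \<le> (\<Sum>t\<in>T. y t * - pairing S x (f t))"
    by (simp add: sum_negf swap sum_weights_const[OF x(1)])
  show "pairing T y (g s) = \<alpha>" if "s \<in> S" "x s \<noteq> 0"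
    using weighted_mean_bounds_tight[OF fin(1) x(1) y(2) rows that] .
  show "pairing S x (f t) = \<alpha>" if "t \<in> T" "y t \<noteq> 0"
    using weighted_mean_bounds_tight[OF fin(2) y(1) _ columns that] x(2) by simp
qed

section \<open>The four programs\<close>

theorem theorem3:
  fixes V :: "'a set" and M :: "('a \<Rightarrow> real) set"
  assumes "finite V" and "V \<noteq> {}"
    and "finite M" and "M \<noteq> {}" and "M \<subseteq> nonneg_functions V"
  shows
    "supporting_weights V M \<noteq> {} \<and> covering_weights V M \<noteq> {} \<and>
     supporting_weights M (hat M ` V) \<noteq> {} \<and> covering_weights M (hat M ` V) \<noteq> {} \<and>
     is_lp_dual (problem_hat_B V M) (problem_A V M) \<and>
     is_lp_dual (problem_hat_A V M) (problem_B V M) \<and>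
     (\<forall>\<alpha>A xA \<alpha>B xB \<alpha>hA xhA \<alpha>hB xhB.
        is_solution (problem_A V M) (\<alpha>A, xA) \<and>
        is_solution (problem_B V M) (\<alpha>B, xB) \<and>
        is_solution (problem_hat_A V M) (\<alpha>hA, xhA) \<and>
        is_solution (problem_hat_B V M) (\<alpha>hB, xhB) \<longrightarrow>
        \<alpha>hB = \<alpha>A \<and>
        \<alpha>B = \<alpha>hA \<and>
        ((\<forall>m\<in>M. xhB m \<noteq> 0 \<longrightarrow> (\<Sum>v\<in>V. m v * xA v) = \<alpha>A) \<and>
         (\<forall>v\<in>V. xA v \<noteq> 0 \<longrightarrow> (\<Sum>m\<in>M. m v * xhB m) = \<alpha>A) \<and>
         (\<forall>m\<in>M. xhA m \<noteq> 0 \<longrightarrow> (\<Sum>v\<in>V. m v * xB v) = \<alpha>hA) \<and>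
         (\<forall>v\<in>V. xB v \<noteq> 0 \<longrightarrow> (\<Sum>m\<in>M. m v * xhA m) = \<alpha>hA)) \<and>
        (\<forall>m\<in>M. score V xA m \<ge> \<alpha>A \<and> score V xB m \<le> \<alpha>B \<and> relevant V (\<alpha>A, xA) m))"
proof -
  note fin = assms(1,3)
  have hat_transpose: "hat M v m = m v" if "m \<in> M" for v m
    using that by (simp add: hat_def)
  have pairing_eq: "pairing V x m = (\<Sum>v\<in>V. m v * x v)" for x m
    by (simp add: pairing_def mult.commute)
  have pairing_hat_eq: "pairing M y (hat M v) = (\<Sum>m\<in>M. m v * y m)" for y v
    unfolding pairing_def by (intro sum.cong) (auto simp: hat_transpose)
  have duals: "is_lp_dual (problem_hat_B V M) (problem_A V M)"
    "is_lp_dual (problem_hat_A V M) (problem_B V M)"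
    unfolding problem_A_def problem_B_def problem_hat_A_def problem_hat_B_def
    by (rule is_lp_dual_upper_lower is_lp_dual_lower_upper, simp add: hat_transpose)+
  have solutions: "\<alpha>hB = \<alpha>A \<and> \<alpha>B = \<alpha>hA \<and>
      ((\<forall>m\<in>M. xhB m \<noteq> 0 \<longrightarrow> (\<Sum>v\<in>V. m v * xA v) = \<alpha>A) \<and>
       (\<forall>v\<in>V. xA v \<noteq> 0 \<longrightarrow> (\<Sum>m\<in>M. m v * xhB m) = \<alpha>A) \<and>
       (\<forall>m\<in>M. xhA m \<noteq> 0 \<longrightarrow> (\<Sum>v\<in>V. m v * xB v) = \<alpha>hA) \<and>
       (\<forall>v\<in>V. xB v \<noteq> 0 \<longrightarrow> (\<Sum>m\<in>M. m v * xhA m) = \<alpha>hA)) \<and>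
      (\<forall>m\<in>M. score V xA m \<ge> \<alpha>A \<and> score V xB m \<le> \<alpha>B \<and> relevant V (\<alpha>A, xA) m)"
    if sol: "is_solution (problem_A V M) (\<alpha>A, xA)" "is_solution (problem_B V M) (\<alpha>B, xB)"
      "is_solution (problem_hat_A V M) (\<alpha>hA, xhA)" "is_solution (problem_hat_B V M) (\<alpha>hB, xhB)"
    for \<alpha>A xA \<alpha>B xB \<alpha>hA xhA \<alpha>hB xhB
  proof -
    note sol' = sol[unfolded problem_A_def problem_B_def problem_hat_A_def problem_hat_B_def]
    note A = fin hat_transpose sol'(1,4)
    note hat_A = fin(2,1) hat_transpose[symmetric] sol'(3,2)
    note same_level =
      lower_upper_same_level[where f = "\<lambda>m. m" and g = "hat M", OF A]
      lower_upper_same_level[where f = "hat M" and g = "\<lambda>m. m", OF hat_A]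
    note slackness_A =
      complementary_slackness[where f = "\<lambda>m. m" and g = "hat M", OF A]
    note slackness_hat_A =
      complementary_slackness[where f = "hat M" and g = "\<lambda>m. m", OF hat_A]
    have "\<alpha>hB = \<alpha>A" "\<alpha>B = \<alpha>hA"
      using same_level by auto
    moreover have "(\<Sum>v\<in>V. m v * xA v) = \<alpha>A" if "m \<in> M" "xhB m \<noteq> 0" for m
      using slackness_A(1) that by (simp add: pairing_eq)
    moreover have "(\<Sum>m\<in>M. m v * xhB m) = \<alpha>A" if "v \<in> V" "xA v \<noteq> 0" for v
      using slackness_A(2) that by (simp add: pairing_hat_eq)
    moreover have "(\<Sum>v\<in>V. m v * xB v) = \<alpha>hA" if "m \<in> M" "xhA m \<noteq> 0" for m
      using slackness_hat_A(2) that by (simp add: pairing_eq)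
    moreover have "(\<Sum>m\<in>M. m v * xhA m) = \<alpha>hA" if "v \<in> V" "xB v \<noteq> 0" for v
      using slackness_hat_A(1) that by (simp add: pairing_hat_eq)
    moreover have "\<alpha>A \<le> score V xA m \<and> score V xB m \<le> \<alpha>B" if "m \<in> M" for m
      using sol'(1,2) that
      by (simp add: is_solution_lower_lp_iff is_solution_upper_lp_iff fin score_def pairing_eq)
    ultimately show ?thesis
      by (auto simp: relevant_def)
  qed
  have nonempty: "supporting_weights V M \<noteq> {}" "covering_weights V M \<noteq> {}"
    "supporting_weights M (hat M ` V) \<noteq> {}" "covering_weights M (hat M ` V) \<noteq> {}"
    using assms by (simp_all add: supporting_weights_nonempty covering_weights_nonempty)
  show ?thesis
    by (intro conjI nonempty duals; intro allI impI; elim conjE; rule solutions; assumption)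
qed

end
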